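(* Let $L_E$ be the class-2 nilpotent Lie ring of rank $9$ $$L_E=\left\langle x_1,\ldots,x_6,y_1,y_2,y_3\ \middle|\ [x_1,x_5]=[x_2,x_4]=[x_3,x_6]=y_1,\ [x_1,x_6]=[x_3,x_4]=y_2,\ [x_1,x_4]=[x_2,x_5]=y_3\right\rangle.$$ Then for every prime $p$, $$\zeta_{L_E(\mathbb{F}_p)}^{\triangleleft}(s)=\zeta_{\mathbb{F}_p^6}(s)+p^2|E(\mathbb{F}_p)|\,t^5+|E(\mathbb{F}_p)|(p+p^2)\,t^6+\binom{3}{1}_p t^7+\binom{3}{2}_p t^8+t^9,$$ where $|E(\mathbb{F}_p)|=\left|\{(x:y:z)\in\mathbb{P}^2(\mathbb{F}_p)\ :\ y^2z=x^3-xz^2\}\right|$.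
   Context: A presentation of a Lie ring lists a $\mathbb{Z}$-module basis together with brackets of basis elements; all brackets not listed are zero, up to antisymmetry. For a Lie ring $L\cong\mathbb{Z}^n$ (additively) and a prime $p$, $L(\mathbb{F}_p)=L\otimes_{\mathbb{Z}}\mathbb{F}_p$, and $\zeta_{L(\mathbb{F}_p)}^{\triangleleft}(s)=\sum_{i=0}^{n}a_{p^i}^{\triangleleft}(L(\mathbb{F}_p))\,t^{i}$, where $t=p^{-s}$ and $a_{p^i}^{\triangleleft}(L(\mathbb{F}_p))$ is the number of Lie ideals of $L(\mathbb{F}_p)$ of codimension $i$. $\binom{m}{i}_p$ denotes the Gaussian binomial coefficient (the number of $i$-dimensional subspaces of $\mathbb{F}_p^m$), and $\zeta_{\mathbb{F}_p^m}(s)=\sum_{i=0}^m\binom{m}{i}_p t^i$. *)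

theory Defs
  imports "HOL-Analysis.Analysis" "Berlekamp_Zassenhaus.Finite_Field"
begin

text \<open>
  A presentation with \<open>\<int>\<close>-basis \<open>(e\<^sub>i)\<close> indexed by \<open>'n\<close> is given by a table \<open>B\<close> of listed brackets:
  \<open>B i j\<close> is the value of \<open>[e\<^sub>i, e\<^sub>j]\<close> if that bracket is listed, and \<open>0\<close> otherwise.  Each bracket is
  listed in one order only, so that \<open>[e\<^sub>i, e\<^sub>j] = B i j - B j i\<close>.

  The bracket is defined on \<open>'a ^ 'n\<close> for every commutative ring \<open>'a\<close>: for \<open>'a = int\<close> this is the
  Lie ring \<open>L\<close> itself, and in general it is \<open>L \<otimes>\<^sub>\<int> 'a\<close>, whose structure constants with respect to
  the basis \<open>(e\<^sub>i \<otimes> 1)\<close> are the images in \<open>'a\<close> of those of \<open>L\<close>.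
\<close>

definition lie_bracket ::
    "('n \<Rightarrow> 'n \<Rightarrow> int ^ 'n) \<Rightarrow> 'a::comm_ring_1 ^ 'n::finite \<Rightarrow> 'a ^ 'n \<Rightarrow> 'a ^ 'n" where
  "lie_bracket B u v =
     (\<chi> k. \<Sum>i\<in>UNIV. \<Sum>j\<in>UNIV. of_int ((B i j - B j i) $ k) * (u $ i * v $ j))"

text \<open>Two-sidedness of an ideal is automatic by antisymmetry.\<close>

definition lie_ideal ::
    "('n \<Rightarrow> 'n \<Rightarrow> int ^ 'n) \<Rightarrow> ('a::field ^ 'n::finite) set \<Rightarrow> bool" where
  "lie_ideal B I \<longleftrightarrow> vec.subspace I \<and> (\<forall>u. \<forall>v\<in>I. lie_bracket B u v \<in> I)"

definition num_ideals ::
    "'a::field itself \<Rightarrow> ('n \<Rightarrow> 'n \<Rightarrow> int ^ 'n::finite) \<Rightarrow> nat \<Rightarrow> nat" where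
  "num_ideals _ B i = card {I :: ('a ^ 'n) set. lie_ideal B I \<and> vec.dim I + i = CARD('n)}"

definition ideal_zeta ::
    "'a::{field,finite} itself \<Rightarrow> ('n \<Rightarrow> 'n \<Rightarrow> int ^ 'n::finite) \<Rightarrow> complex \<Rightarrow> complex" where
  "ideal_zeta F B s =
     (\<Sum>i\<le>CARD('n). of_nat (num_ideals F B i) * (of_nat CARD('a) powr (- s)) ^ i)"

definition gauss_binomial ::
    "'a::field itself \<Rightarrow> 'm::finite itself \<Rightarrow> nat \<Rightarrow> nat" where
  "gauss_binomial _ _ i = card {W :: ('a ^ 'm) set. vec.subspace W \<and> vec.dim W = i}"

definition space_zeta ::
    "'a::{field,finite} itself \<Rightarrow> 'm::finite itself \<Rightarrow> complex \<Rightarrow> complex" where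
  "space_zeta F M s =
     (\<Sum>i\<le>CARD('m). of_nat (gauss_binomial F M i) * (of_nat CARD('a) powr (- s)) ^ i)"

definition proj_rel :: "(('a::field ^ 'n) \<times> ('a ^ 'n)) set" where
  "proj_rel = {(u, v). u \<noteq> 0 \<and> v \<noteq> 0 \<and> (\<exists>c. c \<noteq> 0 \<and> v = c *s u)}"

definition proj_space :: "('a::field ^ 'n) set set" where
  "proj_space = {v. v \<noteq> 0} // proj_rel"

text \<open>
  The equation is homogeneous, so it holds for all representatives \<open>(x, y, z)\<close> of a point as soon as
  it holds for one.
\<close>

definition E_points :: "('a::field ^ 3) set set" where
  "E_points = {P \<in> proj_space. \<forall>v\<in>P.
     let x = v $ 1; y = v $ 2; z = v $ 3 in y ^ 2 * z = x ^ 3 - x * z ^ 2}"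

datatype LE_basis = X1 | X2 | X3 | X4 | X5 | X6 | Y1 | Y2 | Y3

lemma UNIV_LE_basis: "UNIV = {X1, X2, X3, X4, X5, X6, Y1, Y2, Y3}"
  by (auto intro: LE_basis.exhaust)

instance LE_basis :: finite
  by standard (simp add: UNIV_LE_basis)

fun LE :: "LE_basis \<Rightarrow> LE_basis \<Rightarrow> int ^ LE_basis" where
  "LE X1 X5 = axis Y1 1"
| "LE X2 X4 = axis Y1 1"
| "LE X3 X6 = axis Y1 1"
| "LE X1 X6 = axis Y2 1"
| "LE X3 X4 = axis Y2 1"
| "LE X1 X4 = axis Y3 1"
| "LE X2 X5 = axis Y3 1"
| "LE _ _ = 0"

lemma lie_bracket_self: "lie_bracket B v v = 0"
proof -
  have "(\<Sum>i\<in>UNIV. \<Sum>j\<in>UNIV. of_int ((B i j - B j i) $ k) * (v $ i * v $ j)) = 0" for k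
  proof -
    have "(\<Sum>i\<in>UNIV. \<Sum>j\<in>UNIV. of_int (B j i $ k) * (v $ i * v $ j)) =
          (\<Sum>i\<in>UNIV. \<Sum>j\<in>UNIV. of_int (B i j $ k) * (v $ i * v $ j))"
      by (subst sum.swap) (simp add: mult.commute)
    then show ?thesis
      by (simp add: left_diff_distrib sum_subtractf)
  qed
  then show ?thesis
    by (simp add: lie_bracket_def vec_eq_iff)
qed

text \<open>In particular the Jacobi identity holds for \<open>LE\<close>.\<close>

lemma LE_class_2: "lie_bracket LE (lie_bracket LE u v) w = 0"
  by (simp add: lie_bracket_def vec_eq_iff UNIV_LE_basis axis_def)

end

theory Submission
  imports Defs
begin

text \<open>
  Let \<open>Z\<close> be the span of the \<open>y\<^sub>i\<close> and sort the ideals \<open>I\<close> by \<open>W = I \<inter> Z\<close>.  If \<open>W = Z\<close>, any subspace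
  \<open>I\<close> containing \<open>Z\<close> is an ideal, and passing to orthogonal complements gives the zeta function of
  the \<open>6\<close>-dimensional space.  If \<open>dim W \<le> 1\<close>, the \<open>2 \<times> 2\<close> minors of the brackets force \<open>I \<subseteq> Z\<close>.  If
  \<open>W\<close> is a plane, the kernel of a functional \<open>\<phi>\<close>, then the image \<open>U\<close> of \<open>I\<close> modulo \<open>Z\<close> is a subspace
  of the radical of the alternating form \<open>\<phi> \<circ> [_, _]\<close>, and each such \<open>U\<close> comes from \<open>p ^ dim U\<close>
  ideals.  The form consists of two blocks given by a symmetric \<open>3 \<times> 3\<close> matrix, up to sign.  The
  determinant of this matrix is the equation of \<open>E\<close> evaluated at \<open>\<phi>\<close>, and its rank is never \<open>1\<close>: the
  radical is a plane if \<open>\<phi> \<in> E\<close> and zero otherwise.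
\<close>

subsection \<open>Subspaces over finite fields\<close>

text \<open>Adjoining a vector \<open>b\<close> outside a span multiplies the cardinality by that of
  the field, because each element of the larger span is \<open>c *s b + v\<close> for exactly one
  pair \<open>(c, v)\<close>. Over a finite field, dimensions can thus be found by counting.\<close>

lemma card_subspace:
  fixes S :: "('a::{field,finite} ^ 'n::finite) set"
  assumes "vec.subspace S"
  shows "card S = CARD('a) ^ vec.dim S"
proof -
  have span: "card (vec.span B) = CARD('a) ^ card B"
    if "vec.independent B" for B :: "('a ^ 'n) set"
  proof -
    have "finite B" by simp
    then show ?thesis using that
    proof (induction B rule: finite_induct)
      case empty
      then show ?case by simp
    next
      case (insert b B)
      have b: "b \<notin> vec.span B" and ind: "vec.independent B"
        using insert.prems insert.hyps(2) by (auto simp: vec.independent_insert)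
      have "bij_betw (\<lambda>(c, v). c *s b + v) (UNIV \<times> vec.span B) (vec.span (insert b B))"
      proof (rule bij_betwI')
        fix x y assume "x \<in> (UNIV :: 'a set) \<times> vec.span B" "y \<in> (UNIV :: 'a set) \<times> vec.span B"
        then obtain c v d w where xy: "x = (c, v)" "y = (d, w)" "v \<in> vec.span B" "w \<in> vec.span B"
          by auto
        have "c = d" if "c *s b + v = d *s b + w"
        proof (rule ccontr)
          assume "c \<noteq> d"
          have "(c - d) *s b = w - v"
            using that by (simp add: algebra_simps)
          then have "(c - d) *s b \<in> vec.span B"
            using xy by (simp add: vec.span_diff)
          then have "inverse (c - d) *s ((c - d) *s b) \<in> vec.span B"
            by (rule vec.span_scale)
          moreover have "inverse (c - d) *s ((c - d) *s b) = b"
            using \<open>c \<noteq> d\<close> by (simp only: vec.scale_scale) simp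
          ultimately show False using b by simp
        qed
        then show "(case x of (c, v) \<Rightarrow> c *s b + v) = (case y of (c, v) \<Rightarrow> c *s b + v) \<longleftrightarrow> x = y"
          using xy by auto
      next
        have "vec.span B \<subseteq> vec.span (insert b B)" by (rule vec.span_mono) auto
        moreover fix x assume "x \<in> (UNIV :: 'a set) \<times> vec.span B"
        ultimately show "(case x of (c, v) \<Rightarrow> c *s b + v) \<in> vec.span (insert b B)"
          by (auto intro!: vec.span_add vec.span_scale intro: vec.span_base)
      next
        fix y assume "y \<in> vec.span (insert b B)"
        then obtain k where "y - k *s b \<in> vec.span B"
          using vec.span_breakdown_eq by blast
        then show "\<exists>x\<in>UNIV \<times> vec.span B. y = (case x of (c, v) \<Rightarrow> c *s b + v)"
          by (intro bexI[of _ "(k, y - k *s b)"]) auto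
      qed
      from bij_betw_same_card[OF this] show ?case
        using insert ind by (simp add: card_cartesian_product)
    qed
  qed
  obtain B where "B \<subseteq> S" "vec.independent B" "S \<subseteq> vec.span B" "card B = vec.dim S"
    using vec.basis_exists by blast
  moreover from this have "vec.span B = S"
    using assms by (metis vec.span_subspace)
  ultimately show ?thesis using span by metis
qed

lemma card_field_gt_1: "CARD('a::{field,finite}) > 1"
proof -
  have "card {0, 1 :: 'a} \<le> CARD('a)" by (rule card_mono) auto
  then show ?thesis by simp
qed

lemma dim_eqI_card:
  fixes S :: "('a::{field,finite} ^ 'n::finite) set"
  assumes "vec.subspace S" "card S = CARD('a) ^ k"
  shows "vec.dim S = k"
  using assms card_subspace[OF assms(1)] card_field_gt_1[where 'a='a] by simp

text \<open>Reduces a sum over subspaces to counts by dimension; the weight \<open>h\<close> will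
  hold a power of \<open>t\<close> and, over a plane of the center, also the number of ideals with a
  given image.\<close>

lemma sum_subspaces_by_dim:
  fixes S :: "('a::{field,finite} ^ 'n::finite) set" and h :: "nat \<Rightarrow> 'b::comm_semiring_1"
  shows "(\<Sum>U\<in>{U. vec.subspace U \<and> U \<subseteq> S}. h (vec.dim U)) =
    (\<Sum>d\<le>vec.dim S. of_nat (card {U. vec.subspace U \<and> U \<subseteq> S \<and> vec.dim U = d}) * h d)"
proof -
  let ?S = "{U. vec.subspace U \<and> U \<subseteq> S}"
  have "(\<Sum>U\<in>?S. h (vec.dim U)) = (\<Sum>d\<le>vec.dim S. \<Sum>U\<in>{U \<in> ?S. vec.dim U = d}. h (vec.dim U))"
    by (rule sum.group[symmetric]) (auto intro: vec.dim_subset)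
  then show ?thesis by simp
qed

lemma card_subspaces_dim_0:
  fixes S :: "('a::field ^ 'n::finite) set"
  assumes "vec.subspace S"
  shows "card {U. vec.subspace U \<and> U \<subseteq> S \<and> vec.dim U = 0} = 1"
proof -
  have "{U. vec.subspace U \<and> U \<subseteq> S \<and> vec.dim U = 0} = {{0}}"
    using vec.subspace_0 assms by auto
  then show ?thesis by simp
qed

lemma card_subspaces_full_dim:
  fixes S :: "('a::field ^ 'n::finite) set"
  assumes "vec.subspace S"
  shows "card {U. vec.subspace U \<and> U \<subseteq> S \<and> vec.dim U = vec.dim S} = 1"
proof -
  have "U = S" if "vec.subspace U" "U \<subseteq> S" "vec.dim U = vec.dim S" for U
    by (rule vec.subspace_dim_equal) (use that assms in auto)
  then have "{U. vec.subspace U \<and> U \<subseteq> S \<and> vec.dim U = vec.dim S} = {S}"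
    using assms by blast
  then show ?thesis by simp
qed

text \<open>The lines partition the nonzero vectors of the plane into classes of size
  \<open>q - 1\<close>, and there are \<open>q ^ 2 - 1\<close> such vectors.\<close>

lemma card_lines_in_plane:
  fixes S :: "('a::{field,finite} ^ 'n::finite) set"
  assumes S: "vec.subspace S" "vec.dim S = 2"
  shows "card {W. vec.subspace W \<and> W \<subseteq> S \<and> vec.dim W = 1} = CARD('a) + 1"
proof -
  let ?L = "{W. vec.subspace W \<and> W \<subseteq> S \<and> vec.dim W = 1}"
  let ?q = "CARD('a)"
  have "S - {0} = (\<Union>W\<in>?L. W - {0})"
  proof (intro equalityI subsetI)
    fix v assume v: "v \<in> S - {0}"
    then have "vec.span {v} \<in> ?L" using S(1) by (auto simp: vec.span_minimal)
    then show "v \<in> (\<Union>W\<in>?L. W - {0})" using v vec.span_base[of v "{v}"] by blast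
  qed auto
  also have "card \<dots> = (\<Sum>W\<in>?L. card (W - {0}))"
  proof (rule card_UN_disjoint)
    have "V = W" if V: "V \<in> ?L" and W: "W \<in> ?L" and x: "x \<in> V" "x \<in> W" "x \<noteq> 0" for V W x
    proof -
      have "vec.span {x} = V"
        by (rule vec.subspace_dim_equal) (use V x in \<open>auto simp: vec.span_minimal\<close>)
      moreover have "vec.span {x} = W"
        by (rule vec.subspace_dim_equal) (use W x in \<open>auto simp: vec.span_minimal\<close>)
      ultimately show ?thesis by simp
    qed
    then show "\<forall>V\<in>?L. \<forall>W\<in>?L. V \<noteq> W \<longrightarrow> (V - {0}) \<inter> (W - {0}) = {}" by blast
  qed auto
  also have "\<dots> = card ?L * (?q - 1)"
    by (simp add: card_subspace vec.subspace_0)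
  finally have eq: "card ?L * (?q - 1) = ?q ^ 2 - 1"
    using S by (simp add: card_subspace vec.subspace_0)
  \<comment> \<open>Writing \<open>q\<close> as \<open>m + 1\<close> removes the truncated
    subtractions; \<open>m\<close> can then be cancelled from \<open>(m + 2) * m\<close>.\<close>
  obtain m where m: "?q = m + 1" "m > 0"
    using card_field_gt_1[where 'a='a] by (metis add.commute less_imp_add_positive)
  have "m \<noteq> 0" using m(2) by simp
  have "card ?L * m = (m + 2) * m"
    using eq unfolding m(1) by (simp add: power2_eq_square algebra_simps)
  with \<open>m \<noteq> 0\<close> have "card ?L = m + 2" by (rule mult_right_cancel[THEN iffD1])
  then show ?thesis using m(1) by simp
qed

subsection \<open>Orthogonal complements\<close>

definition dot :: "'a::field ^ 'n::finite \<Rightarrow> 'a ^ 'n \<Rightarrow> 'a" where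
  "dot u v = (\<Sum>i\<in>UNIV. u $ i * v $ i)"

lemma dot_simps [simp]:
  "dot u (v + w) = dot u v + dot u w" "dot (u + v) w = dot u w + dot v w"
  "dot u (v - w) = dot u v - dot u w" "dot (u - v) w = dot u w - dot v w"
  "dot u (c *s v) = c * dot u v" "dot (c *s u) v = c * dot u v"
  "dot 0 v = 0" "dot u 0 = 0"
  by (simp_all add: dot_def algebra_simps sum.distrib sum_subtractf sum_distrib_left)

lemma dot_commute: "dot u v = dot v u"
  by (simp add: dot_def mult.commute)

lemma dot_axis [simp]: "dot u (axis i 1) = u $ i" "dot (axis i 1) u = u $ i"
  by (simp_all add: dot_def axis_def if_distrib[of "\<lambda>x. _ * x"] if_distrib[of "\<lambda>x. x * _"] cong: if_cong)

text \<open>Orthogonality for the bilinear form \<open>dot\<close>, which may have isotropic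
  vectors: \<open>perp W\<close> can meet \<open>W\<close> nontrivially, so it is complementary in
  dimension only.\<close>

definition perp :: "('a::field ^ 'n::finite) set \<Rightarrow> ('a ^ 'n) set" where
  "perp W = {v. \<forall>w\<in>W. dot w v = 0}"

lemma subspace_perp [simp]: "vec.subspace (perp W)"
  by (auto simp: vec.subspace_def perp_def)

lemma perp_span [simp]: "perp (vec.span W) = perp W"
proof -
  have "dot w v = 0" if "v \<in> perp W" "w \<in> vec.span W" for v w
    using that(2) by (induction rule: vec.span_induct_alt) (use that(1) in \<open>auto simp: perp_def\<close>)
  then show ?thesis by (auto simp: perp_def vec.span_base)
qed

lemma perp_UNIV [simp]: "perp UNIV = {0}"
proof -
  have "v = 0" if "v \<in> perp UNIV" for v :: "'a ^ 'b"
    using that by (auto simp: perp_def vec_eq_iff dest: spec[of _ "axis _ 1"])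
  then show ?thesis by (auto simp: perp_def)
qed

text \<open>Completing a basis \<open>B\<close> of \<open>W\<close> to a basis of the whole space gives coordinates
  in which \<open>perp W\<close> is cut out by the vanishing of the coordinates belonging to \<open>B\<close>.\<close>

lemma dim_perp:
  fixes W :: "('a::field ^ 'n::finite) set"
  shows "vec.dim (perp W) + vec.dim W = CARD('n)"
proof -
  obtain B where B: "B \<subseteq> W" "vec.independent B" "W \<subseteq> vec.span B" "card B = vec.dim W"
    using vec.basis_exists by blast
  then obtain C where C: "B \<subseteq> C" "vec.independent C" "UNIV \<subseteq> vec.span C"
    using vec.maximal_independent_subset_extend[of B UNIV] by auto
  have finC: "finite C" using C(2) vec.finiteI_independent by blast
  have cardC: "card C = CARD('n)"
    using C vec.basis_card_eq_dim[of C UNIV] by (simp add: card_cart_basis)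
  then obtain h where h: "bij_betw h (UNIV :: 'n set) C"
    using finC by (metis finite_same_card_bij finite)
  define D where "D = {i. h i \<in> B}"
  have "bij_betw h D B"
    using h C(1) by (auto simp: bij_betw_def D_def inj_on_def)
  then have cardD: "card D = vec.dim W" using B(4) by (simp add: bij_betw_same_card)
  have imD: "h ` D = B" using \<open>bij_betw h D B\<close> by (simp add: bij_betw_def)
  define g :: "'a ^ 'n \<Rightarrow> 'a ^ 'n" where "g v = (\<chi> i. dot (h i) v)" for v
  have lin: "Vector_Spaces.linear (*s) (*s) g"
    by unfold_locales (auto simp: g_def vec_eq_iff)
  \<comment> \<open>A vector in the kernel of \<open>g\<close> is orthogonal to a spanning set,
    hence to every vector.\<close>
  have inj: "inj g"
  proof (subst vec.linear_inj_iff_eq_0[OF lin], intro allI impI)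
    fix v assume "g v = 0"
    then have "v \<in> perp (range h)" by (auto simp: perp_def g_def vec_eq_iff)
    also have "perp (range h) = perp (vec.span C)"
      using h by (simp add: bij_betw_def)
    also have "\<dots> = {0}" using C(3) by (simp add: top.extremum_unique del: perp_span)
    finally show "v = 0" by simp
  qed
  have surj: "surj g"
    using vec.linear_inj_imp_surj[OF lin inj] by simp
  have "perp W = perp (vec.span B)"
    using B by (metis perp_span vec.span_mono vec.span_span antisym)
  also have "\<dots> = perp (h ` D)" by (simp add: imD)
  also have "\<dots> = g -` {x. \<forall>i. i \<notin> - D \<longrightarrow> x $ i = 0}"
    by (auto simp: perp_def g_def)
  finally have "g ` perp W = {x. \<forall>i. i \<notin> - D \<longrightarrow> x $ i = 0}"
    using surj by (simp only: surj_image_vimage_eq)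
  then have "vec.dim (g ` perp W) = card (- D)"
    by (simp only: dim_substandard_cart)
  moreover have "vec.dim (g ` perp W) = vec.dim (perp W)"
    by (rule vec.dim_image_eq[OF lin]) (use inj in \<open>auto intro: inj_on_subset\<close>)
  moreover have "card (- D) = CARD('n) - card D" "card D \<le> CARD('n)"
    by (simp_all add: Compl_eq_Diff_UNIV card_Diff_subset card_mono)
  ultimately show ?thesis using cardD by simp
qed

text \<open>One inclusion is the symmetry of \<open>dot\<close>; applying \<open>dim_perp\<close>
  twice shows that the dimensions agree.\<close>

lemma perp_perp:
  assumes "vec.subspace W"
  shows "perp (perp W) = W"
proof (rule vec.subspace_dim_equal[symmetric])
  show "W \<subseteq> perp (perp W)" by (auto simp: perp_def dot_commute)
  show "vec.dim (perp (perp W)) \<le> vec.dim W"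
    using dim_perp[of W] dim_perp[of "perp W"] by linarith
qed (use assms in auto)

lemma perp_eq_iff:
  assumes "vec.subspace V" "vec.subspace W"
  shows "perp V = perp W \<longleftrightarrow> V = W"
  using assms perp_perp by metis

lemma perp_anti_mono: "V \<subseteq> W \<Longrightarrow> perp W \<subseteq> perp V"
  by (auto simp: perp_def)

text \<open>Duality: \<open>perp\<close> is an involution on subspaces that exchanges the dimensions
  \<open>i\<close> and \<open>j\<close>.\<close>

lemma gauss_binomial_sym:
  assumes "i + j = CARD('m::finite)"
  shows "gauss_binomial TYPE('a::field) TYPE('m) i = gauss_binomial TYPE('a) TYPE('m) j"
  unfolding gauss_binomial_def
proof (rule bij_betw_same_card[OF bij_betw_byWitness[where f=perp and f'=perp]])
  have "vec.dim (perp W) = i + j - vec.dim W" for W :: "('a ^ 'm) set"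
    using dim_perp[of W] assms by simp
  then show "perp ` {W :: ('a ^ 'm) set. vec.subspace W \<and> vec.dim W = i}
      \<subseteq> {W. vec.subspace W \<and> vec.dim W = j}"
    "perp ` {W :: ('a ^ 'm) set. vec.subspace W \<and> vec.dim W = j}
      \<subseteq> {W. vec.subspace W \<and> vec.dim W = i}"
    by auto
qed (auto simp: perp_perp)

section \<open>Transfer of subspace counts along injective linear maps\<close>

lemma bij_betw_image_subspaces:
  assumes lin: "Vector_Spaces.linear (*s) (*s) (f :: 'a::field ^ 'm::finite \<Rightarrow> 'a ^ 'n::finite)"
    and inj: "inj f"
  shows "bij_betw (image f) {W. vec.subspace W \<and> vec.dim W = i}
    {W. vec.subspace W \<and> W \<subseteq> range f \<and> vec.dim W = i}"
proof -
  have dim: "vec.dim (f ` W) = vec.dim W" for W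
    by (rule vec.dim_image_eq[OF lin]) (use inj in \<open>auto intro: inj_on_subset\<close>)
  show ?thesis
  proof (rule bij_betw_byWitness[where f'="vimage f"])
    show "image f ` {W. vec.subspace W \<and> vec.dim W = i}
        \<subseteq> {W. vec.subspace W \<and> W \<subseteq> range f \<and> vec.dim W = i}"
      using dim vec.linear_subspace_image[OF lin] by auto
    show "vimage f ` {W. vec.subspace W \<and> W \<subseteq> range f \<and> vec.dim W = i}
        \<subseteq> {W. vec.subspace W \<and> vec.dim W = i}"
    proof safe
      fix W assume W: "vec.subspace W" "W \<subseteq> range f"
      show "vec.subspace (f -` W)" using vec.linear_subspace_vimage[OF lin W(1)] .
      have "f ` (f -` W) = W" using W(2) by auto
      then show "vec.dim (f -` W) = vec.dim W" using dim[of "f -` W"] by simp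
    qed
  qed (auto simp: inj inj_vimage_image_eq)
qed

text \<open>Lets subspaces of a coordinate subspace of the Lie ring be counted by Gaussian
  binomials, through an isomorphism with \<open>'a ^ 'm\<close>.\<close>

lemma card_subspaces_of_dim:
  fixes S :: "('a::field ^ 'n::finite) set"
  assumes "vec.subspace S" "vec.dim S = CARD('m::finite)"
  shows "card {W. vec.subspace W \<and> W \<subseteq> S \<and> vec.dim W = i} = gauss_binomial TYPE('a) TYPE('m) i"
proof -
  obtain f :: "'a ^ 'm \<Rightarrow> 'a ^ 'n"
    where lin: "Vector_Spaces.linear (*s) (*s) f" and im: "range f = S" and inj: "inj f"
    using vec.subspace_isomorphism[OF vec.subspace_UNIV assms(1)] assms(2)
    by (metis vec.dim_UNIV card_cart_basis)
  from bij_betw_same_card[OF bij_betw_image_subspaces[OF lin inj, of i]]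
  show ?thesis by (simp add: gauss_binomial_def im)
qed

subsection \<open>Hyperplanes and projective points\<close>

lemma proj_class:
  "v \<noteq> 0 \<Longrightarrow> proj_rel `` {v} = {c *s v | c. c \<noteq> 0}"
  by (auto simp: proj_rel_def)

lemma proj_spaceE:
  assumes "P \<in> proj_space"
  obtains v where "v \<noteq> 0" "P = {c *s v | c. c \<noteq> 0}"
proof -
  from assms obtain v where v: "v \<noteq> 0" "P = proj_rel `` {v}"
    unfolding proj_space_def by (auto elim: quotientE)
  from that[OF v(1)] show ?thesis using v(2) by (simp add: proj_class[OF v(1)])
qed

lemma proj_spaceI: "v \<noteq> 0 \<Longrightarrow> {c *s v | c. c \<noteq> 0} \<in> proj_space"
  by (simp add: proj_class[symmetric] proj_space_def quotientI)

lemma perp_proj_class: "perp {c *s v | c. c \<noteq> 0} = perp {v}"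
proof
  have "v \<in> {c *s v | c. c \<noteq> 0}" by (intro CollectI exI[of _ 1]) simp
  then show "perp {c *s v | c. c \<noteq> 0} \<subseteq> perp {v}" by (intro perp_anti_mono) simp
  show "perp {v} \<subseteq> perp {c *s v | c. c \<noteq> 0}" by (auto simp: perp_def)
qed

text \<open>A hyperplane is the kernel of a nonzero functional that is unique up to a nonzero
  scalar, and functionals are represented by vectors through \<open>dot\<close>.\<close>

lemma bij_betw_perp_proj_space:
  "bij_betw perp (proj_space :: ('a::field ^ 'n::finite) set set)
    {W. vec.subspace W \<and> vec.dim W = CARD('n) - 1}"
proof (rule bij_betw_imageI)
  show "inj_on perp (proj_space :: ('a ^ 'n) set set)"
  proof (rule inj_onI)
    fix P Q :: "('a ^ 'n) set" assume PQ: "P \<in> proj_space" "Q \<in> proj_space" and eq: "perp P = perp Q"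
    obtain u where u: "u \<noteq> 0" "P = {c *s u | c. c \<noteq> 0}" by (rule proj_spaceE[OF PQ(1)])
    obtain v where v: "v \<noteq> 0" "Q = {c *s v | c. c \<noteq> 0}" by (rule proj_spaceE[OF PQ(2)])
    have "perp (vec.span {u}) = perp (vec.span {v})"
      using eq u v by (simp add: perp_proj_class)
    then have "vec.span {u} = vec.span {v}"
      by (subst (asm) perp_eq_iff) auto
    then have "u \<in> vec.span {v}" by (metis vec.span_base singletonI)
    then obtain k where k: "u = k *s v" by (auto simp: vec.span_singleton)
    with u have "k \<noteq> 0" by auto
    have "(\<exists>c. x = c *s u \<and> c \<noteq> 0) \<longleftrightarrow> (\<exists>c. x = c *s v \<and> c \<noteq> 0)" for x
    proof
      assume "\<exists>c. x = c *s u \<and> c \<noteq> 0"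
      then obtain c where "x = (c * k) *s v" "c * k \<noteq> 0" using k \<open>k \<noteq> 0\<close> by auto
      then show "\<exists>c. x = c *s v \<and> c \<noteq> 0" by blast
    next
      assume "\<exists>c. x = c *s v \<and> c \<noteq> 0"
      then obtain c where "x = (c / k) *s u" "c / k \<noteq> 0" using k \<open>k \<noteq> 0\<close> by auto
      then show "\<exists>c. x = c *s u \<and> c \<noteq> 0" by blast
    qed
    then show "P = Q" by (simp add: u v)
  qed
  show "perp ` (proj_space :: ('a ^ 'n) set set) = {W. vec.subspace W \<and> vec.dim W = CARD('n) - 1}"
  proof (intro equalityI subsetI)
    fix W :: "('a ^ 'n) set" assume "W \<in> perp ` proj_space"
    then obtain v where "v \<noteq> 0" "W = perp {v}"
      by (auto elim!: proj_spaceE simp: perp_proj_class)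
    then show "W \<in> {W. vec.subspace W \<and> vec.dim W = CARD('n) - 1}"
      using dim_perp[of "{v}"] by simp
  next
    fix W :: "('a ^ 'n) set" assume "W \<in> {W. vec.subspace W \<and> vec.dim W = CARD('n) - 1}"
    then have W: "vec.subspace W" "vec.dim (perp W) = 1"
      \<comment> \<open>Positivity of \<open>CARD('n)\<close> rules out truncation in
        \<open>CARD('n) - 1\<close>.\<close>
      using dim_perp[of W] zero_less_card_finite[where 'a='n] by (auto simp del: zero_less_card_finite)
    then have "\<not> perp W \<subseteq> {0}" using vec.dim_eq_0[of "perp W"] by linarith
    then obtain v where v: "v \<in> perp W" "v \<noteq> 0" by blast
    have "vec.span {v} = perp W"
      by (rule vec.subspace_dim_equal) (use v W in \<open>auto simp: vec.span_minimal\<close>)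
    then have "perp {v} = W" using perp_perp[OF W(1)] perp_span[of "{v}"] by simp
    then have "W = perp {c *s v | c. c \<noteq> 0}" by (simp add: perp_proj_class)
    then show "W \<in> perp ` proj_space" using proj_spaceI[OF v(2)] by blast
  qed
qed

subsection \<open>Extensions of subspaces along a coordinate projection\<close>

definition coord :: "'n set \<Rightarrow> ('a::field ^ 'n::finite) set" where
  "coord A = {v. \<forall>i. i \<notin> A \<longrightarrow> v $ i = 0}"

text \<open>The kernel of \<open>prj A\<close> is \<open>coord (- A)\<close>, so the image of
  \<open>I\<close> under \<open>prj A\<close> models the image of \<open>I\<close> in the quotient
  by \<open>coord (- A)\<close> without forming a quotient space.\<close>

definition prj :: "'n set \<Rightarrow> 'a::field ^ 'n::finite \<Rightarrow> 'a ^ 'n" where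
  "prj A v = (\<chi> i. if i \<in> A then v $ i else 0)"

lemma subspace_coord [simp]: "vec.subspace (coord A)"
  by (auto simp: vec.subspace_def coord_def)

lemma dim_coord [simp]: "vec.dim (coord A :: ('a::field ^ 'n::finite) set) = card A"
  unfolding coord_def by (rule dim_substandard_cart)

lemma perp_coord [simp]: "perp (coord A :: ('a::field ^ 'n::finite) set) = coord (- A)"
proof (intro equalityI subsetI)
  fix v :: "'a ^ 'n" assume "v \<in> perp (coord A)"
  moreover have "axis i 1 \<in> (coord A :: ('a ^ 'n) set)" if "i \<in> A" for i
    using that by (auto simp: coord_def axis_def)
  ultimately have "dot (axis i 1) v = 0" if "i \<in> A" for i
    using that unfolding perp_def by blast
  then show "v \<in> coord (- A)"
    by (auto simp: coord_def)
qed (auto simp: perp_def coord_def dot_def intro!: sum.neutral, metis)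

lemma linear_prj: "Vector_Spaces.linear (*s) (*s) (prj A)"
  by unfold_locales (auto simp: prj_def vec_eq_iff)

lemma prj_simps [simp]:
  "prj A (u + v) = prj A u + prj A v" "prj A (u - v) = prj A u - prj A v"
  "prj A (c *s v) = c *s prj A v" "prj A 0 = 0"
  by (auto simp: prj_def vec_eq_iff)

lemma prj_in_coord [simp]: "prj A v \<in> coord A"
  by (auto simp: prj_def coord_def)

lemma prj_eq_0_iff: "prj A v = 0 \<longleftrightarrow> v \<in> coord (- A)"
  by (auto simp: prj_def coord_def vec_eq_iff)

lemma prj_eq_self: "v \<in> coord A \<Longrightarrow> prj A v = v"
  by (auto simp: prj_def coord_def vec_eq_iff)

lemma subspace_prj_image: "vec.subspace I \<Longrightarrow> vec.subspace (prj A ` I)"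
  by (rule vec.linear_subspace_image[OF linear_prj])

text \<open>Rank-nullity for \<open>prj A\<close> restricted to \<open>I\<close>, obtained by
  counting: for an arbitrary choice \<open>g\<close> of preimages in \<open>I\<close>, every
  \<open>v\<close> in \<open>I\<close> is \<open>g (prj A v)\<close> plus a unique element of the
  kernel.\<close>

lemma dim_prj:
  fixes I :: "('a::{field,finite} ^ 'n::finite) set"
  assumes I: "vec.subspace I"
  shows "vec.dim I = vec.dim (prj A ` I) + vec.dim (I \<inter> coord (- A))"
proof -
  define g where "g = inv_into I (prj A)"
  have g: "g u \<in> I" "prj A (g u) = u" if "u \<in> prj A ` I" for u
    using that by (auto simp: g_def inv_into_into f_inv_into_f)
  have "bij_betw (\<lambda>(u, w). g u + w) ((prj A ` I) \<times> (I \<inter> coord (- A))) I"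
  proof (rule bij_betw_byWitness[where f'="\<lambda>v. (prj A v, v - g (prj A v))"])
    show "\<forall>x\<in>(prj A ` I) \<times> (I \<inter> coord (- A)).
        (\<lambda>v. (prj A v, v - g (prj A v))) (case x of (u, w) \<Rightarrow> g u + w) = x"
      by (auto simp: g prj_eq_0_iff[symmetric])
    show "(\<lambda>(u, w). g u + w) ` ((prj A ` I) \<times> (I \<inter> coord (- A))) \<subseteq> I"
      using g vec.subspace_add[OF I] by fastforce
    show "(\<lambda>v. (prj A v, v - g (prj A v))) ` I \<subseteq> (prj A ` I) \<times> (I \<inter> coord (- A))"
      using g vec.subspace_diff[OF I] by (auto simp: prj_eq_0_iff[symmetric])
  qed auto
  from bij_betw_same_card[OF this]
  have "CARD('a) ^ vec.dim I
      = CARD('a) ^ (vec.dim (prj A ` I) + vec.dim (I \<inter> coord (- A)))"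
    using card_subspace[OF I] card_subspace[OF subspace_prj_image[OF I, of A]]
      card_subspace[OF vec.subspace_inter[OF I subspace_coord, of "- A"]]
    by (simp add: card_cartesian_product power_add)
  then show ?thesis using card_field_gt_1[where 'a='a] by simp
qed

text \<open>The hyperplane of \<open>coord B\<close> is the full orthogonal complement of
  \<open>coord (- B)\<close> together with \<open>n\<close>, and \<open>n\<close> adds one dimension
  to \<open>coord (- B)\<close>.\<close>

lemma dim_coord_hyperplane:
  fixes n :: "'a::field ^ 'n::finite"
  assumes "n \<in> coord B" "n \<noteq> 0"
  shows "vec.dim {w \<in> coord B. dot n w = 0} + 1 = card B"
proof -
  have notin: "n \<notin> coord (- B)"
    using assms by (auto simp: coord_def vec_eq_iff)
  have "{w \<in> coord B. dot n w = 0} = perp (insert n (coord (- B)))"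
    using perp_coord[of "- B", where 'a='a] by (auto simp: perp_def)
  then have "vec.dim {w \<in> coord B. dot n w = 0} + vec.dim (insert n (coord (- B))) = CARD('n)"
    by (simp only: dim_perp)
  moreover have "vec.dim (insert n (coord (- B))) = card (- B) + 1"
    using notin by (simp add: vec.dim_insert vec.span_eq_iff[THEN iffD2])
  moreover have "card (- B) = CARD('n) - card B" "card B \<le> CARD('n)"
    by (simp_all add: Compl_eq_Diff_UNIV card_Diff_subset card_mono)
  ultimately show ?thesis by linarith
qed

lemma linear_dot_representation:
  fixes g :: "'a::field ^ 'n::finite \<Rightarrow> 'a ^ 'm::finite"
  assumes lin: "Vector_Spaces.linear (*s) (*s) g"
  obtains c where "\<And>x. dot n (g x) = dot c x"
proof
  fix x
  have "g x = matrix g *v x" by (rule matrix_works[OF lin, symmetric])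
  then show "dot n (g x) = dot (transpose (matrix g) *v n) x"
    by (simp add: dot_def matrix_vector_mult_def transpose_def sum_distrib_left sum_distrib_right
        mult_ac) (rule sum.swap)
qed

text \<open>The subspaces being counted are the graphs \<open>{v. prj A v \<in> U \<and> dot n v = dot c (prj A v)}\<close>,
  and two vectors \<open>c\<close> define the same graph iff they agree modulo \<open>perp U\<close>.\<close>

lemma card_subspace_extensions:
  fixes n :: "'a::{field,finite} ^ 'n::finite"
  assumes n: "n \<in> coord (- A)" "n \<noteq> 0" and U: "vec.subspace U" "U \<subseteq> coord A"
  shows "card {I. vec.subspace I \<and> I \<inter> coord (- A) = {w \<in> coord (- A). dot n w = 0}
      \<and> prj A ` I = U} = CARD('a) ^ vec.dim U"
    (is "card ?E = _")
proof -
  obtain i where i: "n $ i \<noteq> 0" using n(2) by (auto simp: vec_eq_iff)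
  then have iA: "i \<notin> A" using n(1) by (auto simp: coord_def)
  \<comment> \<open>A vector of \<open>coord (- A)\<close> on which the functional \<open>n\<close>
    takes the value 1. Adding a multiple of \<open>z\<close> adjusts the value of \<open>n\<close>
    without changing the projection, which lifts each \<open>u\<close> of \<open>U\<close> into
    \<open>J c\<close>.\<close>
  define z where "z = inverse (n $ i) *s axis i (1::'a)"
  have z: "dot n z = 1" "z \<in> coord (- A)"
    using i iA by (simp_all add: z_def, simp add: coord_def axis_def)
  have n0: "dot n u = 0" if "u \<in> coord A" for u
    using that n(1) by (auto simp: dot_def coord_def intro!: sum.neutral, metis)
  define J where "J c = {v. prj A v \<in> U \<and> dot n v = dot c (prj A v)}" for c
  have lift: "u + dot c u *s z \<in> J c" "prj A (u + dot c u *s z) = u" if "u \<in> U" for c u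
  proof -
    have u: "u \<in> coord A" using that U(2) by blast
    show "prj A (u + dot c u *s z) = u"
      using prj_eq_self[OF u] prj_eq_0_iff[of A z] z(2) by simp
    then show "u + dot c u *s z \<in> J c"
      using that n0[OF u] z(1) by (simp add: J_def)
  qed
  have J_eq: "J c = J d \<longleftrightarrow> c - d \<in> perp U" for c d
  proof
    assume eq: "J c = J d"
    have "dot u (c - d) = 0" if "u \<in> U" for u
    proof -
      have "u + dot c u *s z \<in> J d" using lift(1)[OF that] eq by metis
      then have "dot n (u + dot c u *s z) = dot d u"
        unfolding J_def mem_Collect_eq lift(2)[OF that] ..
      then have "dot c u = dot d u"
        using n0[of u] that U(2) z(1) by auto
      then show ?thesis by (simp add: dot_commute)
    qed
    then show "c - d \<in> perp U" by (simp add: perp_def)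
  next
    assume "c - d \<in> perp U"
    then have "dot c u = dot d u" if "u \<in> U" for u
      using that by (auto simp: perp_def dot_commute)
    then show "J c = J d" by (auto simp: J_def)
  qed
  have "?E = range J"
  proof (intro equalityI subsetI)
    fix I assume "I \<in> ?E"
    then have I: "vec.subspace I" "I \<inter> coord (- A) = {w \<in> coord (- A). dot n w = 0}"
      "prj A ` I = U" by auto
    \<comment> \<open>A linear section of the projection turns \<open>I\<close> into a graph:
      \<open>v\<close> lies in \<open>I\<close> iff its difference from \<open>g (prj A v)\<close>
      lies in the kernel of \<open>n\<close>. The parameter \<open>c\<close> represents the
      functional \<open>n\<close> composed with \<open>g\<close>.\<close>
    obtain g where g: "g \<in> prj A ` I \<rightarrow> I" "Vector_Spaces.linear (*s) (*s) g"
      "\<forall>v\<in>prj A ` I. prj A (g v) = v"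
      using vec.linear_exists_right_inverse_on[OF linear_prj I(1), of A] by blast
    obtain c where c: "\<And>x. dot n (g x) = dot c x"
      using linear_dot_representation[OF g(2)] by blast
    have "v \<in> I \<longleftrightarrow> v \<in> J c" for v
    proof (cases "prj A v \<in> U")
      case True
      then have gv: "g (prj A v) \<in> I" "prj A (g (prj A v)) = prj A v"
        using g I(3) by auto
      have "v \<in> I \<longleftrightarrow> v - g (prj A v) \<in> I"
        using vec.subspace_diff[OF I(1) _ gv(1), of v] vec.subspace_add[OF I(1) _ gv(1), of "v - g (prj A v)"]
        by auto
      also have "\<dots> \<longleftrightarrow> v - g (prj A v) \<in> I \<inter> coord (- A)"
        using gv(2) by (simp add: prj_eq_0_iff[symmetric])
      also have "\<dots> \<longleftrightarrow> dot n (v - g (prj A v)) = 0"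
        unfolding I(2) using gv(2) by (simp add: prj_eq_0_iff[symmetric])
      also have "\<dots> \<longleftrightarrow> v \<in> J c"
        using True c by (simp add: J_def)
      finally show ?thesis .
    next
      case False
      then show ?thesis using I(3) by (auto simp: J_def)
    qed
    then show "I \<in> range J" by blast
  next
    fix I assume "I \<in> range J"
    then obtain c where I: "I = J c" by blast
    have "vec.subspace (J c)"
      using U(1) by (auto simp: vec.subspace_def J_def)
    moreover have "J c \<inter> coord (- A) = {w \<in> coord (- A). dot n w = 0}"
      using vec.subspace_0[OF U(1)] by (auto simp: J_def prj_eq_0_iff[symmetric])
    moreover have "prj A ` J c = U"
    proof
      show "prj A ` J c \<subseteq> U" by (auto simp: J_def)
      show "U \<subseteq> prj A ` J c"
      proof
        fix u assume "u \<in> U"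
        from lift[OF this, of c] show "u \<in> prj A ` J c" by (metis imageI)
      qed
    qed
    ultimately show "I \<in> ?E" by (simp add: I)
  qed
  \<comment> \<open>The fibres of \<open>J\<close> are cosets of \<open>perp U\<close>, so they all
    have the same size and partition the whole space.\<close>
  moreover have "CARD('a) ^ vec.dim (perp U) * card (range J) = CARD('a) ^ CARD('n)"
  proof -
    have "(\<Sum>I\<in>range J. card {c \<in> UNIV. J c = I}) = card (UNIV :: ('a ^ 'n) set)"
      using sum.group[of UNIV "range J" J "\<lambda>_. 1::nat"] by simp
    moreover have "card {c \<in> UNIV. J c = I} = CARD('a) ^ vec.dim (perp U)" if "I \<in> range J" for I
    proof -
      from that obtain d where d: "I = J d" by blast
      have "bij_betw (\<lambda>c. c + d) (perp U) {c \<in> UNIV. J c = I}"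
        by (rule bij_betw_byWitness[where f'="\<lambda>c. c - d"]) (auto simp: d J_eq)
      from bij_betw_same_card[OF this] show ?thesis
        by (simp add: card_subspace)
    qed
    ultimately show ?thesis by (simp add: mult.commute)
  qed
  moreover have "CARD('a) ^ CARD('n) = CARD('a) ^ vec.dim (perp U) * CARD('a) ^ vec.dim U"
    by (simp add: power_add[symmetric] dim_perp)
  ultimately show ?thesis by simp
qed

subsection \<open>The Lie ring\<close>

abbreviation LX :: "LE_basis set" where
  "LX \<equiv> {X1, X2, X3, X4, X5, X6}"

lemma card_LX [simp]: "card LX = 6" "card (- LX) = 3" "CARD(LE_basis) = 9"
proof -
  have "- LX = {Y1, Y2, Y3}" using UNIV_LE_basis by auto
  then show "card LX = 6" "card (- LX) = 3" "CARD(LE_basis) = 9"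
    by (simp_all add: UNIV_LE_basis)
qed

lemma LE_coord_center:
  "w \<in> coord (- LX) \<longleftrightarrow> w $ X1 = 0 \<and> w $ X2 = 0 \<and> w $ X3 = 0 \<and> w $ X4 = 0 \<and> w $ X5 = 0 \<and> w $ X6 = 0"
proof -
  have "w \<in> coord (- LX) \<longleftrightarrow> (\<forall>i\<in>LX. w $ i = 0)" unfolding coord_def by blast
  then show ?thesis by simp
qed

lemma LE_coord_LX: "w \<in> coord LX \<longleftrightarrow> w $ Y1 = 0 \<and> w $ Y2 = 0 \<and> w $ Y3 = 0"
proof -
  have "w \<in> coord LX \<longleftrightarrow> (\<forall>i\<in>UNIV. i \<notin> LX \<longrightarrow> w $ i = 0)" unfolding coord_def by blast
  then show ?thesis unfolding UNIV_LE_basis by simp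
qed

lemma LE_vec_eqI:
  assumes "u $ X1 = w $ X1" "u $ X2 = w $ X2" "u $ X3 = w $ X3" "u $ X4 = w $ X4"
    "u $ X5 = w $ X5" "u $ X6 = w $ X6" "u $ Y1 = w $ Y1" "u $ Y2 = w $ Y2" "u $ Y3 = w $ Y3"
  shows "u = (w :: 'a ^ LE_basis)"
proof -
  have "\<forall>i\<in>{X1, X2, X3, X4, X5, X6, Y1, Y2, Y3}. u $ i = w $ i" using assms by simp
  then show ?thesis unfolding UNIV_LE_basis[symmetric] by (simp add: vec_eq_iff)
qed

lemma lie_bracket_LE:
  fixes u v :: "'a::comm_ring_1 ^ LE_basis"
  shows "lie_bracket LE u v $ Y1 = u $ X1 * v $ X5 - u $ X5 * v $ X1 + u $ X2 * v $ X4
      - u $ X4 * v $ X2 + u $ X3 * v $ X6 - u $ X6 * v $ X3"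
    and "lie_bracket LE u v $ Y2 = u $ X1 * v $ X6 - u $ X6 * v $ X1 + u $ X3 * v $ X4
      - u $ X4 * v $ X3"
    and "lie_bracket LE u v $ Y3 = u $ X1 * v $ X4 - u $ X4 * v $ X1 + u $ X2 * v $ X5
      - u $ X5 * v $ X2"
    and "lie_bracket LE u v $ X1 = 0" "lie_bracket LE u v $ X2 = 0" "lie_bracket LE u v $ X3 = 0"
    and "lie_bracket LE u v $ X4 = 0" "lie_bracket LE u v $ X5 = 0" "lie_bracket LE u v $ X6 = 0"
  by (simp_all add: lie_bracket_def UNIV_LE_basis axis_def algebra_simps)

lemma lie_bracket_LE_center: "lie_bracket LE u v \<in> coord (- LX)"
  by (simp add: LE_coord_center lie_bracket_LE)

lemma lie_bracket_LE_prj: "lie_bracket LE u (prj LX v) = lie_bracket LE u v"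
  by (rule LE_vec_eqI) (simp_all add: lie_bracket_LE prj_def)

lemma lie_bracket_LE_central: "w \<in> coord (- LX) \<Longrightarrow> lie_bracket LE u w = 0"
  by (rule LE_vec_eqI) (simp_all add: lie_bracket_LE LE_coord_center)

text \<open>The sign in the last coordinate turns the determinant of the bracket form
  \<open>(u, x) \<mapsto> dot (center_embed v) [u, x]\<close> into the Weierstrass equation of \<open>E\<close>.\<close>

definition center_embed :: "'a::field ^ 3 \<Rightarrow> 'a ^ LE_basis" where
  "center_embed v = (\<chi> i. case i of Y1 \<Rightarrow> v $ 1 | Y2 \<Rightarrow> v $ 2 | Y3 \<Rightarrow> - v $ 3 | _ \<Rightarrow> 0)"

lemma center_embed_nth [simp]:
  "center_embed v $ Y1 = v $ 1" "center_embed v $ Y2 = v $ 2" "center_embed v $ Y3 = - v $ 3"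
  "center_embed v $ X1 = 0" "center_embed v $ X2 = 0" "center_embed v $ X3 = 0"
  "center_embed v $ X4 = 0" "center_embed v $ X5 = 0" "center_embed v $ X6 = 0"
  by (simp_all add: center_embed_def)

lemma linear_center_embed: "Vector_Spaces.linear (*s) (*s) center_embed"
  by unfold_locales (rule LE_vec_eqI; simp)+

lemma inj_center_embed: "inj center_embed"
proof (rule injI)
  fix v w :: "'a ^ 3" assume "center_embed v = center_embed w"
  from this[THEN arg_cong, of "\<lambda>x. x $ Y1"] this[THEN arg_cong, of "\<lambda>x. x $ Y2"]
    this[THEN arg_cong, of "\<lambda>x. x $ Y3"]
  show "v = w" by (simp add: vec_eq_iff forall_3)
qed

lemma range_center_embed: "range center_embed = coord (- LX)"
proof (intro equalityI subsetI)
  fix w :: "'a ^ LE_basis" assume "w \<in> coord (- LX)"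
  then have "w = center_embed (vector [w $ Y1, w $ Y2, - w $ Y3])"
    by (intro LE_vec_eqI) (simp_all add: LE_coord_center)
  then show "w \<in> range center_embed" by (rule range_eqI)
qed (auto simp: LE_coord_center)

lemma dot_LE:
  "dot u w = u $ X1 * w $ X1 + u $ X2 * w $ X2 + u $ X3 * w $ X3 + u $ X4 * w $ X4 + u $ X5 * w $ X5
    + u $ X6 * w $ X6 + u $ Y1 * w $ Y1 + u $ Y2 * w $ Y2 + u $ Y3 * w $ Y3"
  by (simp add: dot_def UNIV_LE_basis add_ac)

text \<open>The sign in the third coordinate occurs twice and cancels, so orthogonality in the
  center can be computed in three coordinates.\<close>

lemma dot_center_embed: "dot (center_embed v) (center_embed w) = dot v w"
  by (simp add: dot_LE) (simp add: dot_def sum_3)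

lemma center_embed_perp:
  "center_embed ` perp {v} = {w \<in> coord (- LX). dot (center_embed v) w = 0}"
  unfolding range_center_embed[symmetric] by (auto simp: perp_def dot_center_embed)

lemma center_embed_nonzero: "v \<noteq> 0 \<Longrightarrow> center_embed v \<noteq> 0"
  using inj_center_embed[THEN injD, of v 0]
  by (metis vec.linear_0[OF linear_center_embed])

section \<open>The cubic equation on representatives of projective points\<close>

definition on_E :: "'a::field ^ 3 \<Rightarrow> bool" where
  "on_E v \<longleftrightarrow> v $ 2 ^ 2 * v $ 3 = v $ 1 ^ 3 - v $ 1 * v $ 3 ^ 2"

text \<open>The left side of the equation is \<open>a * d ^ 2 - a ^ 3 - b ^ 2 * d\<close>, the
  determinant of the matrix behind \<open>LE_ker\<close>, at \<open>a = v $ 1\<close>,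
  \<open>b = v $ 2\<close>, \<open>d = - v $ 3\<close>.\<close>

lemma on_E_iff_det:
  "on_E v \<longleftrightarrow> v $ 1 * (- v $ 3) ^ 2 - v $ 1 ^ 3 - v $ 2 ^ 2 * - v $ 3 = 0"
proof -
  have "v $ 1 * (- v $ 3) ^ 2 - v $ 1 ^ 3 - v $ 2 ^ 2 * - v $ 3
      = v $ 2 ^ 2 * v $ 3 - (v $ 1 ^ 3 - v $ 1 * v $ 3 ^ 2)"
    by simp
  then show ?thesis unfolding on_E_def by (simp only: eq_iff_diff_eq_0[symmetric])
qed

lemma on_E_scale: "c \<noteq> 0 \<Longrightarrow> on_E (c *s v) \<longleftrightarrow> on_E v"
proof -
  assume "c \<noteq> 0"
  have "on_E (c *s v) \<longleftrightarrow> c ^ 3 * (v $ 2 ^ 2 * v $ 3) = c ^ 3 * (v $ 1 ^ 3 - v $ 1 * v $ 3 ^ 2)"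
    by (simp add: on_E_def power2_eq_square power3_eq_cube algebra_simps)
  then show ?thesis using \<open>c \<noteq> 0\<close> by (simp add: on_E_def)
qed

lemma E_points_class:
  assumes "v \<noteq> 0"
  shows "{c *s v | c. c \<noteq> 0} \<in> E_points \<longleftrightarrow> on_E v"
proof -
  have "v \<in> {c *s v | c. c \<noteq> 0}" by (intro CollectI exI[of _ 1]) simp
  then have "(\<forall>w\<in>{c *s v | c. c \<noteq> 0}. on_E w) \<longleftrightarrow> on_E v"
    by (auto simp: on_E_scale)
  then show ?thesis
    using proj_spaceI[OF assms] unfolding E_points_def on_E_def Let_def by simp
qed

text \<open>The kernel of the symmetric matrix with rows \<open>(d, a, b)\<close>, \<open>(a, d, 0)\<close>, \<open>(b, 0, a)\<close>.\<close>

definition LE_ker :: "'a::field \<Rightarrow> 'a \<Rightarrow> 'a \<Rightarrow> 'a \<Rightarrow> 'a \<Rightarrow> 'a \<Rightarrow> bool" where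
  "LE_ker a b d x y z \<longleftrightarrow> d * x + a * y + b * z = 0 \<and> a * x + d * y = 0 \<and> b * x + a * z = 0"

text \<open>Cramer's rule: combining the three equations with the rows of the adjugate matrix gives
  the determinant times each unknown.\<close>

lemma LE_ker_trivial:
  assumes "a * d ^ 2 - a ^ 3 - b ^ 2 * d \<noteq> 0" "LE_ker a b d x y z"
  shows "x = 0" "y = 0" "z = 0"
proof -
  have e: "d * x + a * y + b * z = 0" "a * x + d * y = 0" "b * x + a * z = 0"
    using assms(2) by (auto simp: LE_ker_def)
  have "(a * d ^ 2 - a ^ 3 - b ^ 2 * d) * x
      = d * a * (d * x + a * y + b * z) - a ^ 2 * (a * x + d * y) - b * d * (b * x + a * z)"
    by (simp add: algebra_simps power2_eq_square power3_eq_cube)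
  then show "x = 0" using assms(1) e by simp
  have "(a * d ^ 2 - a ^ 3 - b ^ 2 * d) * y
      = - (a ^ 2) * (d * x + a * y + b * z) + (d * a - b ^ 2) * (a * x + d * y) + a * b * (b * x + a * z)"
    by (simp add: algebra_simps power2_eq_square power3_eq_cube)
  then show "y = 0" using assms(1) e by simp
  have "(a * d ^ 2 - a ^ 3 - b ^ 2 * d) * z
      = - b * d * (d * x + a * y + b * z) + a * b * (a * x + d * y) + (d ^ 2 - a ^ 2) * (b * x + a * z)"
    by (simp add: algebra_simps power2_eq_square power3_eq_cube)
  then show "z = 0" using assms(1) e by simp
qed

text \<open>A nonzero matrix of this shape with vanishing determinant has rank exactly 2. If
  \<open>a\<close> is nonzero, the last two equations determine \<open>x\<close> and
  \<open>z\<close> from \<open>y\<close>, and the first then follows from the determinant.\<close>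

lemma LE_ker_line:
  assumes "a * d ^ 2 - a ^ 3 - b ^ 2 * d = 0" "a \<noteq> 0 \<or> b \<noteq> 0 \<or> d \<noteq> 0"
  obtains k l m :: "'a::field" where "k \<noteq> 0 \<or> l \<noteq> 0 \<or> m \<noteq> 0"
    and "\<And>x y z. LE_ker a b d x y z \<longleftrightarrow> (\<exists>c. x = c * k \<and> y = c * l \<and> z = c * m)"
proof -
  \<comment> \<open>For \<open>a = 0\<close> the determinant is \<open>- (b ^ 2 * d)\<close>, so
    exactly one of \<open>b\<close> and \<open>d\<close> is nonzero.\<close>
  consider "a \<noteq> 0" | "a = 0" "b = 0" "d \<noteq> 0" | "a = 0" "b \<noteq> 0" "d = 0"
    using assms by force
  then show thesis
  proof cases
    case 1
    show thesis
    proof (rule that[of d "- a" "- (b * d) / a"])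
      fix x y z
      show "LE_ker a b d x y z \<longleftrightarrow> (\<exists>c. x = c * d \<and> y = c * - a \<and> z = c * (- (b * d) / a))"
      proof
        assume "LE_ker a b d x y z"
        then have e: "a * x = - (d * y)" "a * z = - (b * x)"
          by (auto simp: LE_ker_def add_eq_0_iff2 add_eq_0_iff)
        have x: "x = (- y / a) * d" using e(1) 1 by (simp add: field_simps)
        have "z = - (b * x) / a" using e(2) 1 by (simp add: field_simps)
        with x have "x = (- y / a) * d \<and> y = (- y / a) * - a \<and> z = (- y / a) * (- (b * d) / a)"
          using 1 by simp
        then show "\<exists>c. x = c * d \<and> y = c * - a \<and> z = c * (- (b * d) / a)" by blast
      next
        assume "\<exists>c. x = c * d \<and> y = c * - a \<and> z = c * (- (b * d) / a)"
        then obtain c where c: "x = c * d" "y = c * - a" "z = c * (- (b * d) / a)" by blast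
        have "a * (d * x + a * y + b * z) = c * (a * d ^ 2 - a ^ 3 - b ^ 2 * d)"
          using 1 by (simp add: c field_simps power2_eq_square power3_eq_cube)
        then have "d * x + a * y + b * z = 0" using assms(1) 1 by simp
        then show "LE_ker a b d x y z" using 1 by (simp add: LE_ker_def c)
      qed
    qed (use 1 in simp)
  next
    case 2
    show thesis by (rule that[of 0 0 1]) (use 2 in \<open>auto simp: LE_ker_def\<close>)
  next
    case 3
    show thesis by (rule that[of 0 1 0]) (use 3 in \<open>auto simp: LE_ker_def\<close>)
  qed
qed

text \<open>The largest possible image, modulo the center, of an ideal whose intersection with the center
  is the plane \<open>center_embed ` perp {v}\<close>.\<close>

definition LE_radical :: "'a::field ^ 3 \<Rightarrow> ('a ^ LE_basis) set" where
  "LE_radical v = {x \<in> coord LX. \<forall>u. dot (center_embed v) (lie_bracket LE u x) = 0}"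

text \<open>All listed brackets pair one of \<open>X1\<close>, \<open>X2\<close>, \<open>X3\<close>
  with one of \<open>X4\<close>, \<open>X5\<close>, \<open>X6\<close>. The form therefore splits
  into two blocks, each the same symmetric matrix up to sign, and the two halves of \<open>x\<close>
  satisfy the same linear system independently.\<close>

lemma LE_radical_iff:
  "x \<in> LE_radical v \<longleftrightarrow> x \<in> coord LX \<and>
    LE_ker (v $ 1) (v $ 2) (- v $ 3) (x $ X1) (x $ X2) (x $ X3) \<and>
    LE_ker (v $ 1) (v $ 2) (- v $ 3) (x $ X4) (x $ X5) (x $ X6)"
proof (cases "x \<in> coord LX")
  case True
  let ?f = "\<lambda>u. dot (center_embed v) (lie_bracket LE u x)"
  let ?R = "LE_ker (v $ 1) (v $ 2) (- v $ 3) (x $ X1) (x $ X2) (x $ X3) \<and>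
    LE_ker (v $ 1) (v $ 2) (- v $ 3) (x $ X4) (x $ X5) (x $ X6)"
  have f: "?f u =
      u $ X1 * (- v $ 3 * x $ X4 + v $ 1 * x $ X5 + v $ 2 * x $ X6)
    + u $ X2 * (v $ 1 * x $ X4 + - v $ 3 * x $ X5) + u $ X3 * (v $ 2 * x $ X4 + v $ 1 * x $ X6)
    - u $ X4 * (- v $ 3 * x $ X1 + v $ 1 * x $ X2 + v $ 2 * x $ X3)
    - u $ X5 * (v $ 1 * x $ X1 + - v $ 3 * x $ X2) - u $ X6 * (v $ 2 * x $ X1 + v $ 1 * x $ X3)" for u
    by (simp add: dot_LE lie_bracket_LE algebra_simps)
  have "?R" if "\<forall>u. ?f u = 0"
  proof -
    \<comment> \<open>The value \<open>- 1\<close> in the last three test vectors compensates the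
      sign of the second block.\<close>
    have "?f (axis X1 1) = 0" "?f (axis X2 1) = 0" "?f (axis X3 1) = 0"
      "?f (axis X4 (- 1)) = 0" "?f (axis X5 (- 1)) = 0" "?f (axis X6 (- 1)) = 0"
      using that by blast+
    then show ?thesis unfolding f LE_ker_def by (simp add: axis_def add.commute)
  qed
  moreover have "\<forall>u. ?f u = 0" if ?R
    using that unfolding f LE_ker_def by simp
  ultimately show ?thesis using True unfolding LE_radical_def by blast
qed (simp add: LE_radical_def)

lemma subspace_LE_radical [simp]: "vec.subspace (LE_radical v)"
  unfolding vec.subspace_def
proof (intro conjI ballI allI)
  show "0 \<in> LE_radical v" by (simp add: LE_radical_iff coord_def LE_ker_def)
next
  fix x y assume "x \<in> LE_radical v" "y \<in> LE_radical v"
  then have "dot (center_embed v) (lie_bracket LE u (x + y)) = 0" for u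
  proof -
    have "lie_bracket LE u (x + y) = lie_bracket LE u x + lie_bracket LE u y"
      by (rule LE_vec_eqI) (simp_all add: lie_bracket_LE algebra_simps)
    then show ?thesis using \<open>x \<in> LE_radical v\<close> \<open>y \<in> LE_radical v\<close>
      by (simp add: LE_radical_def)
  qed
  then show "x + y \<in> LE_radical v"
    using \<open>x \<in> LE_radical v\<close> \<open>y \<in> LE_radical v\<close> by (simp add: LE_radical_def coord_def)
next
  fix c x assume x: "x \<in> LE_radical v"
  have "lie_bracket LE u (c *s x) = c *s lie_bracket LE u x" for u
    by (rule LE_vec_eqI) (simp_all add: lie_bracket_LE algebra_simps)
  then show "c *s x \<in> LE_radical v"
    using x by (simp add: LE_radical_def coord_def)
qed

lemma LE_radical_trivial:
  assumes "\<not> on_E v"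
  shows "LE_radical v = {0}"
proof -
  have *: "v $ 1 * (- v $ 3) ^ 2 - v $ 1 ^ 3 - v $ 2 ^ 2 * - v $ 3 \<noteq> 0"
    using assms by (simp only: on_E_iff_det not_False_eq_True)
  have "x = 0" if "x \<in> LE_radical v" for x
    using that LE_ker_trivial[OF *] unfolding LE_radical_iff
    by (intro LE_vec_eqI) (auto simp: LE_coord_LX)
  then show ?thesis using vec.subspace_0[OF subspace_LE_radical] by blast
qed

text \<open>The radical is two copies of the kernel line, one in each half of the coordinates;
  \<open>f\<close> parametrizes it by pairs of scalars, which gives \<open>q ^ 2\<close>
  elements.\<close>

lemma dim_LE_radical:
  fixes v :: "'a::{field,finite} ^ 3"
  assumes "on_E v" "v \<noteq> 0"
  shows "vec.dim (LE_radical v) = 2"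
proof (rule dim_eqI_card)
  have "v $ 1 * (- v $ 3) ^ 2 - v $ 1 ^ 3 - v $ 2 ^ 2 * - v $ 3 = 0"
    using assms(1) by (simp only: on_E_iff_det)
  moreover have "v $ 1 \<noteq> 0 \<or> v $ 2 \<noteq> 0 \<or> - v $ 3 \<noteq> 0"
    using assms(2) by (auto simp: vec_eq_iff forall_3)
  ultimately obtain k l m where klm: "k \<noteq> 0 \<or> l \<noteq> 0 \<or> m \<noteq> 0"
    and ker: "\<And>x y z. LE_ker (v $ 1) (v $ 2) (- v $ 3) x y z \<longleftrightarrow>
      (\<exists>c. x = c * k \<and> y = c * l \<and> z = c * m)"
    by (rule LE_ker_line) blast
  define f where "f = (\<lambda>(c, d). \<chi> i. case i of X1 \<Rightarrow> c * k | X2 \<Rightarrow> c * l | X3 \<Rightarrow> c * m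
    | X4 \<Rightarrow> d * k | X5 \<Rightarrow> d * l | X6 \<Rightarrow> d * m | _ \<Rightarrow> 0)"
  have f: "f (c, d) $ X1 = c * k" "f (c, d) $ X2 = c * l" "f (c, d) $ X3 = c * m"
    "f (c, d) $ X4 = d * k" "f (c, d) $ X5 = d * l" "f (c, d) $ X6 = d * m"
    "f (c, d) $ Y1 = 0" "f (c, d) $ Y2 = 0" "f (c, d) $ Y3 = 0" for c d
    by (simp_all add: f_def)
  have "inj f"
  proof (rule injI)
    fix x y assume eq: "f x = f y"
    obtain c d c' d' where xy: "x = (c, d)" "y = (c', d')" by fastforce
    have "f x $ i = f y $ i" for i using eq by simp
    from this[of X1] this[of X2] this[of X3] this[of X4] this[of X5] this[of X6]
    show "x = y" using klm unfolding xy f by auto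
  qed
  moreover have "range f = LE_radical v"
  proof (intro equalityI subsetI)
    fix x assume "x \<in> range f"
    then obtain c d where "x = f (c, d)" by auto
    then show "x \<in> LE_radical v" by (auto simp: LE_radical_iff LE_coord_LX f ker)
  next
    fix x assume "x \<in> LE_radical v"
    then obtain c d where "x $ X1 = c * k \<and> x $ X2 = c * l \<and> x $ X3 = c * m"
      "x $ X4 = d * k \<and> x $ X5 = d * l \<and> x $ X6 = d * m" "x \<in> coord LX"
      unfolding LE_radical_iff ker by blast
    then have "x = f (c, d)" by (intro LE_vec_eqI) (simp_all add: f LE_coord_LX)
    then show "x \<in> range f" by blast
  qed
  ultimately have "card (LE_radical v) = CARD('a \<times> 'a)"
    using card_image[of f UNIV] by simp
  then show "card (LE_radical v) = CARD('a) ^ 2" by (simp add: power2_eq_square)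
qed simp

subsection \<open>Counting ideals\<close>

lemma sum_power_by_value:
  fixes t :: "'b::comm_semiring_1"
  assumes "finite S" "\<And>x. x \<in> S \<Longrightarrow> f x \<le> n"
  shows "(\<Sum>i\<le>n. of_nat (card {x \<in> S. f x = i}) * t ^ i) = (\<Sum>x\<in>S. t ^ f x)"
proof -
  have "(\<Sum>x\<in>S. t ^ f x) = (\<Sum>i\<le>n. \<Sum>x\<in>{x \<in> S. f x = i}. t ^ f x)"
    by (rule sum.group[symmetric]) (use assms in auto)
  also have "\<dots> = (\<Sum>i\<le>n. of_nat (card {x \<in> S. f x = i}) * t ^ i)"
    by simp
  finally show ?thesis ..
qed

text \<open>One term per ideal, so that the ideals can be sorted by their intersection with the
  center instead of by codimension.\<close>

lemma ideal_zeta_eq_sum: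
  "ideal_zeta TYPE('a::{field,finite}) (B :: 'n \<Rightarrow> 'n \<Rightarrow> int ^ 'n::finite) s =
    (\<Sum>I\<in>{I :: ('a ^ 'n) set. lie_ideal B I}. (of_nat CARD('a) powr (- s)) ^ (CARD('n) - vec.dim I))"
proof -
  have dim: "vec.dim I \<le> CARD('n)" for I :: "('a ^ 'n) set"
    using dim_perp[of I] by linarith
  have "num_ideals TYPE('a) B i
      = card {I \<in> {I :: ('a ^ 'n) set. lie_ideal B I}. CARD('n) - vec.dim I = i}"
    if "i \<le> CARD('n)" for i
  proof -
    have "vec.dim I + i = CARD('n) \<longleftrightarrow> CARD('n) - vec.dim I = i" for I :: "('a ^ 'n) set"
      using that dim[of I] by linarith
    then show ?thesis by (simp add: num_ideals_def)
  qed
  then have "ideal_zeta TYPE('a) B s =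
    (\<Sum>i\<le>CARD('n). of_nat (card {I \<in> {I :: ('a ^ 'n) set. lie_ideal B I}. CARD('n) - vec.dim I = i})
      * (of_nat CARD('a) powr (- s)) ^ i)"
    unfolding ideal_zeta_def by (intro sum.cong) simp_all
  also have "\<dots> = (\<Sum>I\<in>{I :: ('a ^ 'n) set. lie_ideal B I}.
      (of_nat CARD('a) powr (- s)) ^ (CARD('n) - vec.dim I))"
    by (rule sum_power_by_value) simp_all
  finally show ?thesis .
qed

section \<open>The ideal condition, according to the intersection with the center\<close>

lemma lie_ideal_LE_above_center:
  assumes "vec.subspace I" "coord (- LX) \<subseteq> I"
  shows "lie_ideal LE I"
  using assms lie_bracket_LE_center unfolding lie_ideal_def by blast

lemma lie_ideal_LE_in_center:
  assumes "vec.subspace I" "I \<subseteq> coord (- LX)"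
  shows "lie_ideal LE I"
  unfolding lie_ideal_def
proof (intro conjI allI ballI)
  fix u v assume "v \<in> I"
  then have "lie_bracket LE u v = 0" using assms(2) by (intro lie_bracket_LE_central) auto
  then show "lie_bracket LE u v \<in> I" by (simp add: vec.subspace_0[OF assms(1)])
qed (rule assms(1))

text \<open>Every bracket is central, so it lies in \<open>I\<close> iff it lies in the plane, that
  is, iff the functional \<open>v\<close> kills it; and brackets see \<open>I\<close> only modulo
  the center.\<close>

lemma lie_ideal_LE_over_plane:
  assumes "vec.subspace I" "I \<inter> coord (- LX) = center_embed ` perp {v}"
  shows "lie_ideal LE I \<longleftrightarrow> prj LX ` I \<subseteq> LE_radical v"
proof -
  have "lie_bracket LE u x \<in> I \<longleftrightarrow> lie_bracket LE u x \<in> I \<inter> coord (- LX)" for u x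
    using lie_bracket_LE_center by blast
  then have *: "lie_bracket LE u x \<in> I \<longleftrightarrow> dot (center_embed v) (lie_bracket LE u x) = 0" for u x
    using lie_bracket_LE_center unfolding assms(2) center_embed_perp by blast
  show ?thesis
    using assms(1) by (auto simp: lie_ideal_def * LE_radical_def lie_bracket_LE_prj)
qed

text \<open>The brackets of \<open>x\<close> with the basis vectors all lie on one line, so any two
  of them are proportional and every \<open>2 \<times> 2\<close> minor of their coordinates
  vanishes.\<close>

lemma lie_ideal_LE_low_dim:
  assumes I: "lie_ideal LE I" and dim: "vec.dim (I \<inter> coord (- LX)) \<le> 1"
  shows "I \<subseteq> coord (- LX)"
proof
  fix x assume x: "x \<in> I"
  let ?b = "\<lambda>i. lie_bracket LE (axis i 1) x"
  obtain B where B: "I \<inter> coord (- LX) \<subseteq> vec.span B" "card B \<le> 1" "vec.independent B"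
    using vec.basis_exists[of "I \<inter> coord (- LX)"] dim by metis
  have "finite B" using B(3) vec.finiteI_independent by blast
  \<comment> \<open>Inclusion instead of equality also covers an empty \<open>B\<close>, where the
    intersection is zero.\<close>
  then obtain w where "B \<subseteq> {w}" using B(2) by (metis card_le_Suc0_iff_eq One_nat_def subsetI insert_iff)
  then have w: "I \<inter> coord (- LX) \<subseteq> vec.span {w}" using B(1) vec.span_mono by blast
  have "?b i \<in> I \<inter> coord (- LX)" for i
    using I x lie_bracket_LE_center by (simp add: lie_ideal_def)
  then have "\<forall>i. \<exists>c. ?b i = c *s w" using w by (auto simp: vec.span_singleton)
  then obtain c where c: "\<And>i. ?b i = c i *s w" by metis
  have minor: "?b i $ k * ?b j $ l = ?b i $ l * ?b j $ k" for i j k l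
    unfolding c by (simp add: algebra_simps)
  \<comment> \<open>In each chosen minor one product is the square of the wanted coordinate, while
    the other vanishes outright or by coordinates already known to be zero.\<close>
  have x4: "x $ X4 = 0"
    using minor[of X2 Y1 X3 Y2] by (simp add: lie_bracket_LE axis_def)
  have x5: "x $ X5 = 0"
    using minor[of X1 Y1 X2 Y3] x4 by (simp add: lie_bracket_LE axis_def)
  have x6: "x $ X6 = 0"
    using minor[of X1 Y2 X3 Y1] x4 x5 by (simp add: lie_bracket_LE axis_def)
  have x1: "x $ X1 = 0"
    using minor[of X5 Y1 X6 Y2] by (simp add: lie_bracket_LE axis_def)
  have x2: "x $ X2 = 0"
    using minor[of X4 Y1 X5 Y3] x1 by (simp add: lie_bracket_LE axis_def)
  have x3: "x $ X3 = 0"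
    using minor[of X4 Y2 X6 Y1] x1 x2 by (simp add: lie_bracket_LE axis_def)
  show "x \<in> coord (- LX)" using x1 x2 x3 x4 x5 x6 by (simp add: LE_coord_center)
qed

section \<open>Contributions to the zeta function by dimension of the central part\<close>

text \<open>The image \<open>U = 0\<close> contributes \<open>t ^ 7\<close>. On the cubic, the
  radical is a plane: each of its \<open>q + 1\<close> lines carries \<open>q\<close> ideals of
  codimension 6, and the plane itself carries \<open>q ^ 2\<close> ideals of codimension 5.\<close>

lemma sum_ideals_over_plane:
  fixes v :: "'a::{field,finite} ^ 3" and t :: "'b::comm_semiring_1"
  assumes v: "v \<noteq> 0"
  defines "q \<equiv> of_nat CARD('a)"
  shows "(\<Sum>I\<in>{I. lie_ideal LE I \<and> I \<inter> coord (- LX) = center_embed ` perp {v}}. t ^ (9 - vec.dim I))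
    = t ^ 7 + (if on_E v then (q + 1) * q * t ^ 6 + q ^ 2 * t ^ 5 else 0)"
proof -
  let ?P = "center_embed ` perp {v}"
  let ?F = "{I. lie_ideal LE I \<and> I \<inter> coord (- LX) = ?P}"
  let ?S = "{U. vec.subspace U \<and> U \<subseteq> LE_radical v}"
  have n: "center_embed v \<in> coord (- LX)" "center_embed v \<noteq> 0"
    using range_center_embed center_embed_nonzero[OF v] by auto
  have dimP: "vec.dim ?P = 2"
    using dim_coord_hyperplane[OF n] unfolding center_embed_perp by simp
  have sub: "vec.subspace I" if "I \<in> ?F" for I
    using that by (simp add: lie_ideal_def)
  have dimI: "9 - vec.dim I = 7 - vec.dim (prj LX ` I)" if "I \<in> ?F" for I
    using dim_prj[OF sub[OF that], of LX] that dimP by simp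
  have "(\<Sum>I\<in>?F. t ^ (9 - vec.dim I)) = (\<Sum>I\<in>?F. t ^ (7 - vec.dim (prj LX ` I)))"
    using dimI by (intro sum.cong) simp_all
  also have "\<dots> = (\<Sum>U\<in>?S. \<Sum>I\<in>{I \<in> ?F. prj LX ` I = U}. t ^ (7 - vec.dim (prj LX ` I)))"
  proof (rule sum.group[symmetric])
    show "image (prj LX) ` ?F \<subseteq> ?S"
    proof (rule image_subsetI)
      fix I assume I: "I \<in> ?F"
      then show "prj LX ` I \<in> ?S"
        using lie_ideal_LE_over_plane[OF sub[OF I]] subspace_prj_image[OF sub[OF I]] by simp
    qed
  qed simp_all
  also have "\<dots> = (\<Sum>U\<in>?S. q ^ vec.dim U * t ^ (7 - vec.dim U))"
  proof (rule sum.cong[OF refl])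
    fix U assume U: "U \<in> ?S"
    then have UX: "vec.subspace U" "U \<subseteq> coord LX" by (auto simp: LE_radical_def)
    \<comment> \<open>Since \<open>U\<close> lies in the radical, every subspace over the plane with
      image \<open>U\<close> is an ideal, and \<open>card_subspace_extensions\<close> counts
      them.\<close>
    have "{I \<in> ?F. prj LX ` I = U} = {I. vec.subspace I \<and> I \<inter> coord (- LX) = ?P \<and> prj LX ` I = U}"
    proof (intro Collect_cong)
      fix I
      show "I \<in> ?F \<and> prj LX ` I = U \<longleftrightarrow>
          vec.subspace I \<and> I \<inter> coord (- LX) = ?P \<and> prj LX ` I = U"
        using U lie_ideal_LE_over_plane[of I v] by (auto simp: lie_ideal_def)
    qed
    then have "card {I \<in> ?F. prj LX ` I = U} = CARD('a) ^ vec.dim U"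
      using card_subspace_extensions[OF n UX] unfolding center_embed_perp by simp
    moreover have "(\<Sum>I\<in>{I \<in> ?F. prj LX ` I = U}. t ^ (7 - vec.dim (prj LX ` I)))
        = (\<Sum>I\<in>{I \<in> ?F. prj LX ` I = U}. t ^ (7 - vec.dim U))"
      by (intro sum.cong) auto
    ultimately show "(\<Sum>I\<in>{I \<in> ?F. prj LX ` I = U}. t ^ (7 - vec.dim (prj LX ` I)))
        = q ^ vec.dim U * t ^ (7 - vec.dim U)"
      by (simp only: sum_constant q_def of_nat_power)
  qed
  also have "\<dots> = (\<Sum>d\<le>vec.dim (LE_radical v).
      of_nat (card {U. vec.subspace U \<and> U \<subseteq> LE_radical v \<and> vec.dim U = d}) * (q ^ d * t ^ (7 - d)))"
    by (rule sum_subspaces_by_dim)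
  also have "\<dots> = t ^ 7 + (if on_E v then (q + 1) * q * t ^ 6 + q ^ 2 * t ^ 5 else 0)"
  proof (cases "on_E v")
    case True
    then have dim: "vec.dim (LE_radical v) = 2" using dim_LE_radical v by blast
    have "{..2::nat} = {0, 1, 2}" by auto
    moreover have "card {U. vec.subspace U \<and> U \<subseteq> LE_radical v \<and> vec.dim U = 2} = 1"
      using card_subspaces_full_dim[OF subspace_LE_radical, of v] by (simp add: dim)
    moreover note card_lines_in_plane[OF subspace_LE_radical dim]
      card_subspaces_dim_0[OF subspace_LE_radical, of v]
    ultimately show ?thesis using True
      unfolding dim by (simp add: q_def algebra_simps)
  next
    case False
    then have dim: "vec.dim (LE_radical v) = 0" by (simp add: LE_radical_trivial)
    show ?thesis using False card_subspaces_dim_0[OF subspace_LE_radical, of v]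
      unfolding dim by simp
  qed
  finally show ?thesis .
qed

lemma bij_betw_center_planes:
  "bij_betw (\<lambda>P. center_embed ` perp P) (proj_space :: ('a::field ^ 3) set set)
    {W. vec.subspace W \<and> W \<subseteq> coord (- LX) \<and> vec.dim W = 2}"
proof -
  have "bij_betw perp (proj_space :: ('a ^ 3) set set) {W. vec.subspace W \<and> vec.dim W = 2}"
    using bij_betw_perp_proj_space[where 'a='a and 'n=3] by simp
  from bij_betw_trans[OF this
      bij_betw_image_subspaces[OF linear_center_embed inj_center_embed, of 2]]
  show ?thesis by (simp add: o_def range_center_embed)
qed

text \<open>The planes of the center correspond to the points of the projective plane: all of them
  contribute \<open>t ^ 7\<close>, and those on the cubic also give the two lower powers.\<close>

lemma sum_ideals_dim_center_2:
  fixes t :: "'b::comm_semiring_1"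
  defines "NE \<equiv> card (E_points :: ('a::{field,finite} ^ 3) set set)" and "q \<equiv> CARD('a)"
  shows "(\<Sum>I\<in>{I :: ('a ^ LE_basis) set. lie_ideal LE I \<and> vec.dim (I \<inter> coord (- LX)) = 2}.
      t ^ (9 - vec.dim I)) =
    of_nat (gauss_binomial TYPE('a) TYPE(3) 1) * t ^ 7
      + of_nat (NE * (q + q ^ 2)) * t ^ 6 + of_nat (q ^ 2 * NE) * t ^ 5"
proof -
  let ?F = "{I :: ('a ^ LE_basis) set. lie_ideal LE I \<and> vec.dim (I \<inter> coord (- LX)) = 2}"
  let ?T = "{W :: ('a ^ LE_basis) set. vec.subspace W \<and> W \<subseteq> coord (- LX) \<and> vec.dim W = 2}"
  let ?h = "\<lambda>W. \<Sum>I\<in>{I. lie_ideal LE I \<and> I \<inter> coord (- LX) = W}. t ^ (9 - vec.dim I)"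
  let ?PS = "proj_space :: ('a ^ 3) set set" and ?E = "E_points :: ('a ^ 3) set set"
  let ?c = "of_nat (q + q ^ 2) * t ^ 6 + of_nat (q ^ 2) * t ^ 5 :: 'b"
  have "(\<Sum>I\<in>?F. t ^ (9 - vec.dim I))
      = (\<Sum>W\<in>?T. \<Sum>I\<in>{I \<in> ?F. I \<inter> coord (- LX) = W}. t ^ (9 - vec.dim I))"
    by (rule sum.group[symmetric]) (auto simp: lie_ideal_def intro: vec.subspace_inter)
  also have "\<dots> = (\<Sum>W\<in>?T. ?h W)"
    by (intro sum.cong) auto
  also have "\<dots> = (\<Sum>P\<in>?PS. ?h (center_embed ` perp P))"
    by (rule sum.reindex_bij_betw[OF bij_betw_center_planes, symmetric])
  also have "\<dots> = (\<Sum>P\<in>?PS. t ^ 7 + (if P \<in> ?E then ?c else 0))"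
  proof (rule sum.cong[OF refl])
    fix P assume "P \<in> ?PS"
    then obtain v where v: "v \<noteq> 0" and P: "P = {c *s v | c. c \<noteq> 0}" by (rule proj_spaceE)
    have "?h (center_embed ` perp {v}) = t ^ 7 + (if on_E v then ?c else 0)"
      using sum_ideals_over_plane[OF v, of t] by (simp add: q_def algebra_simps power2_eq_square)
    then show "?h (center_embed ` perp P) = t ^ 7 + (if P \<in> ?E then ?c else 0)"
      unfolding P perp_proj_class E_points_class[OF v] .
  qed
  also have "\<dots> = (\<Sum>P\<in>?PS. t ^ 7) + (\<Sum>P\<in>?PS. if P \<in> ?E then ?c else 0)"
    by (rule sum.distrib)
  also have "(\<Sum>P\<in>?PS. if P \<in> ?E then ?c else 0) = (\<Sum>P\<in>?PS \<inter> ?E. ?c)"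
    by (rule sum.inter_restrict[symmetric]) simp
  also have "(\<Sum>P\<in>?PS. t ^ 7) = of_nat (card ?PS) * t ^ 7" by simp
  also have "?PS \<inter> ?E = ?E" by (auto simp: E_points_def)
  \<comment> \<open>Points are counted as planes of the 3-space through \<open>perp\<close>; duality
    then turns planes into lines.\<close>
  also have "card ?PS = gauss_binomial TYPE('a) TYPE(3) 2"
    using bij_betw_same_card[OF bij_betw_perp_proj_space[where 'a='a and 'n=3]]
    by (simp add: gauss_binomial_def)
  also have "\<dots> = gauss_binomial TYPE('a) TYPE(3) 1"
    by (rule gauss_binomial_sym) simp
  finally show ?thesis by (simp add: NE_def algebra_simps)
qed

text \<open>Such ideals lie in the center, where every subspace is an ideal: the lines give
  \<open>t ^ 8\<close> and the zero ideal gives \<open>t ^ 9\<close>.\<close>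

lemma sum_ideals_low_dim_center:
  fixes t :: "'b::comm_semiring_1"
  shows "(\<Sum>I\<in>{I :: ('a::{field,finite} ^ LE_basis) set.
      lie_ideal LE I \<and> vec.dim (I \<inter> coord (- LX)) \<le> 1}. t ^ (9 - vec.dim I)) =
    of_nat (gauss_binomial TYPE('a) TYPE(3) 1) * t ^ 8 + t ^ 9"
proof -
  let ?F = "{I :: ('a ^ LE_basis) set. lie_ideal LE I \<and> vec.dim (I \<inter> coord (- LX)) \<le> 1}"
  let ?S = "{U :: ('a ^ LE_basis) set. vec.subspace U \<and> U \<subseteq> coord (- LX)}"
  have F: "?F = {I \<in> ?S. vec.dim I \<le> 1}"
  proof (intro equalityI subsetI)
    fix I assume "I \<in> ?F"
    moreover from this have "I \<subseteq> coord (- LX)" using lie_ideal_LE_low_dim by blast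
    moreover from this have "I \<inter> coord (- LX) = I" by blast
    ultimately show "I \<in> {I \<in> ?S. vec.dim I \<le> 1}" by (simp add: lie_ideal_def)
  next
    fix I assume I: "I \<in> {I \<in> ?S. vec.dim I \<le> 1}"
    then have "I \<inter> coord (- LX) = I" by blast
    then show "I \<in> ?F" using I by (simp add: lie_ideal_LE_in_center)
  qed
  have "(\<Sum>I\<in>?F. t ^ (9 - vec.dim I))
      = (\<Sum>U\<in>?S. if vec.dim U \<le> 1 then t ^ (9 - vec.dim U) else 0)"
    unfolding F by (rule sum.inter_filter) simp
  also have "\<dots> = (\<Sum>d\<le>vec.dim (coord (- LX) :: ('a ^ LE_basis) set).
      of_nat (card {U :: ('a ^ LE_basis) set. vec.subspace U \<and> U \<subseteq> coord (- LX) \<and> vec.dim U = d})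
        * (if d \<le> 1 then t ^ (9 - d) else 0))"
    by (rule sum_subspaces_by_dim)
  also have "\<dots> = of_nat (gauss_binomial TYPE('a) TYPE(3) 1) * t ^ 8 + t ^ 9"
  proof -
    have "{..3::nat} = {0, 1, 2, 3}" by auto
    moreover have "card {U :: ('a ^ LE_basis) set. vec.subspace U \<and> U \<subseteq> coord (- LX) \<and> vec.dim U = 1}
        = gauss_binomial TYPE('a) TYPE(3) 1"
      by (rule card_subspaces_of_dim) simp_all
    moreover note card_subspaces_dim_0[OF subspace_coord, of "- LX", where 'a='a]
    ultimately show ?thesis by (simp add: add.commute)
  qed
  finally show ?thesis .
qed

text \<open>Taking \<open>perp\<close> turns the subspaces above the center into the subspaces of
  \<open>coord LX\<close> and codimension into dimension, which matches \<open>space_zeta\<close>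
  term by term.\<close>

lemma sum_ideals_above_center:
  "(\<Sum>I\<in>{I :: ('a::{field,finite} ^ LE_basis) set. lie_ideal LE I \<and> vec.dim (I \<inter> coord (- LX)) = 3}.
      (of_nat CARD('a) powr (- s)) ^ (9 - vec.dim I)) = space_zeta TYPE('a) TYPE(6) s"
proof -
  let ?t = "of_nat CARD('a) powr (- s) :: complex"
  let ?F = "{I :: ('a ^ LE_basis) set. lie_ideal LE I \<and> vec.dim (I \<inter> coord (- LX)) = 3}"
  let ?S = "{U :: ('a ^ LE_basis) set. vec.subspace U \<and> U \<subseteq> coord LX}"
  have F: "I \<in> ?F \<longleftrightarrow> vec.subspace I \<and> coord (- LX) \<subseteq> I" for I
  proof
    assume I: "I \<in> ?F"
    then have "I \<inter> coord (- LX) = coord (- LX)"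
      by (intro vec.subspace_dim_equal) (auto simp: lie_ideal_def intro!: vec.subspace_inter)
    then show "vec.subspace I \<and> coord (- LX) \<subseteq> I" using I by (auto simp: lie_ideal_def)
  next
    assume I: "vec.subspace I \<and> coord (- LX) \<subseteq> I"
    then have "I \<inter> coord (- LX) = coord (- LX)" by blast
    then show "I \<in> ?F" using I by (simp add: lie_ideal_LE_above_center)
  qed
  have LX: "perp (coord LX :: ('a ^ LE_basis) set) = coord (- LX)" "perp (coord (- LX) :: ('a ^ LE_basis) set) = coord LX"
    by (simp_all only: perp_coord double_compl)
  have "bij_betw perp ?S ?F"
  proof (rule bij_betw_byWitness[where f'=perp])
    show "perp ` ?S \<subseteq> ?F"
    proof
      fix I assume "I \<in> perp ` ?S"
      then obtain U where "I = perp U" "U \<subseteq> coord LX" by blast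
      then show "I \<in> ?F" unfolding F using perp_anti_mono[of U "coord LX"] by (simp add: LX)
    qed
    show "perp ` ?F \<subseteq> ?S"
    proof
      fix U assume "U \<in> perp ` ?F"
      then obtain I where "U = perp I" "I \<in> ?F" by blast
      then show "U \<in> ?S" unfolding F using perp_anti_mono[of "coord (- LX)" I] by (simp add: LX)
    qed
    show "\<forall>U\<in>?S. perp (perp U) = U" by (simp add: perp_perp)
    show "\<forall>I\<in>?F. perp (perp I) = I" by (simp add: perp_perp lie_ideal_def)
  qed
  then have "(\<Sum>I\<in>?F. ?t ^ (9 - vec.dim I)) = (\<Sum>U\<in>?S. ?t ^ (9 - vec.dim (perp U)))"
    by (rule sum.reindex_bij_betw[symmetric])
  also have "\<dots> = (\<Sum>U\<in>?S. ?t ^ vec.dim U)"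
  proof (rule sum.cong[OF refl])
    fix U :: "('a ^ LE_basis) set"
    have "9 - vec.dim (perp U) = vec.dim U" using dim_perp[of U] by simp
    then show "?t ^ (9 - vec.dim (perp U)) = ?t ^ vec.dim U" by simp
  qed
  also have "\<dots> = (\<Sum>d\<le>vec.dim (coord LX :: ('a ^ LE_basis) set).
      of_nat (card {U :: ('a ^ LE_basis) set. vec.subspace U \<and> U \<subseteq> coord LX \<and> vec.dim U = d}) * ?t ^ d)"
    by (rule sum_subspaces_by_dim)
  also have "\<dots> = space_zeta TYPE('a) TYPE(6) s"
  proof -
    have "card {U :: ('a ^ LE_basis) set. vec.subspace U \<and> U \<subseteq> coord LX \<and> vec.dim U = d}
        = gauss_binomial TYPE('a) TYPE(6) d" for d
      by (rule card_subspaces_of_dim) simp_all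
    then show ?thesis by (simp add: space_zeta_def)
  qed
  finally show ?thesis .
qed

theorem theorem4p1:
  fixes p :: nat and s :: complex
  assumes p: "p = CARD('p::prime_card)"
  defines "t \<equiv> of_nat p powr (- s)"
    and "NE \<equiv> card (E_points :: ('p mod_ring ^ 3) set set)"
  shows "ideal_zeta TYPE('p mod_ring) LE s =
           space_zeta TYPE('p mod_ring) TYPE(6) s
         + of_nat (p ^ 2 * NE) * t ^ 5
         + of_nat (NE * (p + p ^ 2)) * t ^ 6
         + of_nat (gauss_binomial TYPE('p mod_ring) TYPE(3) 1) * t ^ 7
         + of_nat (gauss_binomial TYPE('p mod_ring) TYPE(3) 2) * t ^ 8
         + t ^ 9"
proof -
  let ?c = "\<lambda>I. vec.dim (I \<inter> coord (- LX))"
  let ?F = "{I :: ('p mod_ring ^ LE_basis) set. lie_ideal LE I}"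
  let ?F3 = "{I :: ('p mod_ring ^ LE_basis) set. lie_ideal LE I \<and> ?c I = 3}"
  let ?F2 = "{I :: ('p mod_ring ^ LE_basis) set. lie_ideal LE I \<and> ?c I = 2}"
  let ?F1 = "{I :: ('p mod_ring ^ LE_basis) set. lie_ideal LE I \<and> ?c I \<le> 1}"
  have q: "CARD('p mod_ring) = p" using p by simp
  have "?c I \<le> 3" for I :: "('p mod_ring ^ LE_basis) set"
    using vec.dim_subset[of "I \<inter> coord (- LX)" "coord (- LX)"] by simp
  then have "?c I = 3 \<or> ?c I = 2 \<or> ?c I \<le> 1" for I :: "('p mod_ring ^ LE_basis) set"
    by (metis One_nat_def Suc_1 le_Suc_eq numeral_3_eq_3)
  then have F: "?F = ?F3 \<union> (?F2 \<union> ?F1)" by blast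
  have "ideal_zeta TYPE('p mod_ring) LE s = (\<Sum>I\<in>?F. t ^ (9 - vec.dim I))"
    by (simp only: ideal_zeta_eq_sum q t_def card_LX)
  also have "\<dots> = (\<Sum>I\<in>?F3. t ^ (9 - vec.dim I))
      + ((\<Sum>I\<in>?F2. t ^ (9 - vec.dim I)) + (\<Sum>I\<in>?F1. t ^ (9 - vec.dim I)))"
    unfolding F by (subst sum.union_disjoint; (subst sum.union_disjoint)?) auto
  also have "(\<Sum>I\<in>?F3. t ^ (9 - vec.dim I)) = space_zeta TYPE('p mod_ring) TYPE(6) s"
    using sum_ideals_above_center[where 'a="'p mod_ring"] by (simp only: q t_def)
  finally have "ideal_zeta TYPE('p mod_ring) LE s = space_zeta TYPE('p mod_ring) TYPE(6) s
      + ((\<Sum>I\<in>?F2. t ^ (9 - vec.dim I)) + (\<Sum>I\<in>?F1. t ^ (9 - vec.dim I)))" .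
  \<comment> \<open>The coefficient of \<open>t ^ 8\<close> was obtained as a number of lines;
    duality rewrites it as the number of planes in the claim.\<close>
  moreover have "gauss_binomial TYPE('p mod_ring) TYPE(3) 1 = gauss_binomial TYPE('p mod_ring) TYPE(3) 2"
    by (rule gauss_binomial_sym) simp
  ultimately show ?thesis
    unfolding sum_ideals_dim_center_2 sum_ideals_low_dim_center q NE_def
    by (simp add: add_ac)
qed

end
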